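(* Let $p$ be prime, let $n \geq 2$ be an integer, and let $m = n-1$. Let $L: \mathbb{F}_p^n \to \mathbb{F}_p^m$ be an $\mathbb{F}_p$-linear map of rank $m$. Let $S \subseteq [n]$ be the unique element of $\mathsf{suppker}(L)$, and let $S' = [n] \setminus S$ (so that $2^{S' \cup S} \cap \mathsf{suppker}(L) = \{S\}$). Let $k$ be an integer with $1 \le k \le p$ and let $k_1 = k_2 = \cdots = k_n = k$. Define $$\lambda = \left(\prod_{i\in S} k_i - \prod_{i\in S} (k_i-1) \right) \cdot \prod_{i \in S'} k_i .$$ Then: 1. If $p \geq 2k-1$, there exist $A_1, \ldots, A_n \subseteq \mathbb{F}_p$ with $|A_i| = k_i$ for each $i$ such that $| L(A_1, \ldots, A_n)| = \lambda$. 2. If $p < 2k-1$, there exist $A_1, \ldots, A_n \subseteq \mathbb{F}_p$ with $|A_i| = k_i$ for each $i$ such that $| L(A_1, \ldots, A_n)| < \lambda$.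
   Context: $\mathbb{F}_p$ is the field of integers modulo $p$, $[n] = \{1,\ldots,n\}$, and $2^{T}$ denotes the set of all subsets of $T$. For $v \in \mathbb{F}_p^n$, $\mathrm{supp}(v) = \{ i \in [n] \mid v_i \neq 0\}$. For a linear map $L: \mathbb{F}_p^n \to \mathbb{F}_p^m$, its support-kernel is $\mathsf{suppker}(L) = \{ S \subseteq [n] \mid \exists v \in \ker(L),\ v \neq 0,\ \mathrm{supp}(v) = S\}$. When $m=n-1$ and $L$ has rank $m$, the kernel is one-dimensional, so $\mathsf{suppker}(L)$ has exactly one element. For subsets $A_1,\ldots,A_n \subseteq \mathbb{F}_p$, $L(A_1, \ldots, A_n) = \{ L(a_1, \ldots, a_n) \mid a_i \in A_i \text{ for each } i \}$. Empty products equal $1$.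
   Formalization: Part 2 is stated with the extra hypothesis |S| ≥ 2; if |S| = 1, then |L(A_1,…,A_n)| = k^{n-1} = λ for every choice of the A_i, so part 2 fails as written (e.g. p = k = 2, n = 2, L(x,y) = x). *)

theory Defs
  imports "HOL-Analysis.Analysis" "Berlekamp_Zassenhaus.Finite_Field"
begin

text \<open>
  The field of integers modulo a prime \<open>p\<close> is \<open>'p mod_ring\<close> with \<open>'p :: prime_card\<close> and
  \<open>CARD('p) = p\<close>.  Coordinates are indexed by finite types, so \<open>[n]\<close> is \<open>UNIV :: 'n set\<close>
  with \<open>CARD('n) = n\<close>.
\<close>

definition vsupp :: "'a::zero ^ 'n \<Rightarrow> 'n set" where
  "vsupp v = {i. v $ i \<noteq> 0}"

definition suppker :: "('a::zero ^ 'n \<Rightarrow> 'a ^ 'm) \<Rightarrow> 'n set set" where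
  "suppker L = {S. \<exists>v. L v = 0 \<and> v \<noteq> 0 \<and> vsupp v = S}"

definition box_image :: "('a ^ 'n \<Rightarrow> 'a ^ 'm) \<Rightarrow> ('n \<Rightarrow> 'a set) \<Rightarrow> ('a ^ 'm) set" where
  "box_image L A = {L (\<chi> i. a i) | a. \<forall>i. a i \<in> A i}"

text \<open>
  If \<open>S = {i}\<close> is the unique element of \<open>suppker L\<close>, then \<open>L\<close> forgets coordinate \<open>i\<close> and is
  injective in the others, so \<open>box_image L A\<close> has exactly \<open>lam S ks\<close> elements for all nonempty
  \<open>A j\<close> with \<open>card (A j) = ks j\<close>.  Hence strictly fewer elements are possible only
  for \<open>card S \<ge> 2\<close>.
\<close>

definition lam :: "'n::finite set \<Rightarrow> ('n \<Rightarrow> nat) \<Rightarrow> int" where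
  "lam S ks = ((\<Prod>i\<in>S. int (ks i)) - (\<Prod>i\<in>S. int (ks i) - 1)) * (\<Prod>i\<in>UNIV - S. int (ks i))"

end

theory Submission
  imports Defs
begin

text \<open>
  Write \<open>v\<close> for a kernel vector with support \<open>S\<close>; since every nonzero kernel vector has the same
  support, the kernel is the line through \<open>v\<close>.  Take every \<open>A i\<close> to be a dilate of
  \<open>{0, \<dots>, k - 1}\<close>, with ratio \<open>v $ i\<close> for \<open>i \<in> S\<close> and ratio \<open>1\<close> otherwise.  In the grid coordinates
  \<open>x :: 'n \<Rightarrow> nat\<close> with \<open>x i < k\<close>, the kernel direction becomes the all-ones vector on \<open>S\<close>: two
  grid points have the same image iff they agree off \<open>S\<close> and differ on \<open>S\<close> by a constant
  modulo \<open>p\<close> (\<open>grid_point_image_eq_iff\<close>).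

  Subtracting from \<open>x\<close> its minimum over \<open>S\<close> leaves its image unchanged, so grid points that vanish
  somewhere on \<open>S\<close> already give the whole image, and there are exactly \<open>\<lambda>\<close> of these
  (\<open>card_grid_vanishing\<close>).  The image therefore has at most \<open>\<lambda>\<close> elements, with equality iff no two
  such grid points are identified.  If \<open>x i = 0\<close> and \<open>y j = 0\<close>, an identification forces
  \<open>x j + y i \<equiv> 0\<close> modulo \<open>p\<close>, where \<open>x j + y i \<le> 2 * k - 2\<close>.  For \<open>p \<ge> 2 * k - 1\<close>
  there is thus no wraparound and \<open>x = y\<close>; for \<open>p \<le> 2 * k - 2\<close> and \<open>card S \<ge> 2\<close> a
  decomposition \<open>p = (k - 1) + (p - k + 1)\<close> produces a collision.
\<close>

lemma of_nat_mod_ring_eq_iff: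
  assumes "a < CARD('p)" "b < CARD('p)"
  shows "(of_nat a :: 'p::prime_card mod_ring) = of_nat b \<longleftrightarrow> a = b"
  using assms by (metis of_nat_eq_iff_cong_CHAR semiring_char_mod_ring cong_less_modulus_unique_nat)

lemma card_grid_vanishing:
  fixes ks :: "'n::finite \<Rightarrow> nat"
  assumes "\<And>i. 1 \<le> ks i"
  shows "int (card {x. (\<forall>i. x i < ks i) \<and> (\<exists>i\<in>S. x i = 0)}) = lam S ks"
proof -
  define X where "X = PiE UNIV (\<lambda>i. {..<ks i})"
  define Y where "Y = PiE UNIV (\<lambda>i. if i \<in> S then {1..<ks i} else {..<ks i})"
  have X: "x \<in> X \<longleftrightarrow> (\<forall>i. x i < ks i)" for x
    by (auto simp: X_def PiE_UNIV_domain Pi_def)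
  have Y: "x \<in> Y \<longleftrightarrow> (\<forall>i. x i < ks i) \<and> (\<forall>i\<in>S. x i \<noteq> 0)" for x
    proof -
    have "x \<in> Y \<longleftrightarrow> (\<forall>i. x i \<in> (if i \<in> S then {1..<ks i} else {..<ks i}))"
      by (simp add: Y_def PiE_UNIV_domain Pi_def)
    also have "\<dots> \<longleftrightarrow> (\<forall>i. x i < ks i \<and> (i \<in> S \<longrightarrow> x i \<noteq> 0))"
      by (intro iff_allI) auto
    finally show ?thesis by blast
  qed
  have "x \<in> {x. (\<forall>i. x i < ks i) \<and> (\<exists>i\<in>S. x i = 0)} \<longleftrightarrow> x \<in> X - Y" for x
    unfolding mem_Collect_eq Diff_iff X Y by metis
  then have "{x. (\<forall>i. x i < ks i) \<and> (\<exists>i\<in>S. x i = 0)} = X - Y"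
    by (intro subset_antisym subsetI) simp_all
  moreover have "Y \<subseteq> X" "finite X"
    using X Y by (auto simp: X_def intro!: finite_PiE)
  ultimately have "int (card {x. (\<forall>i. x i < ks i) \<and> (\<exists>i\<in>S. x i = 0)}) = int (card X) - int (card Y)"
    by (metis card_Diff_subset card_mono finite_subset of_nat_diff)
  moreover have split: "prod f UNIV = prod f S * prod f (UNIV - S)" for f :: "'n \<Rightarrow> int"
    by (metis Compl_eq_Diff_UNIV finite mult.commute prod.subset_diff subset_UNIV)
  have "int (card X) = (\<Prod>i\<in>S. int (ks i)) * (\<Prod>i\<in>UNIV - S. int (ks i))"
    by (simp add: X_def card_PiE split)
  moreover have "int (card Y) = (\<Prod>i\<in>S. int (ks i) - 1) * (\<Prod>i\<in>UNIV - S. int (ks i))"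
    using assms by (simp add: Y_def card_PiE split of_nat_diff)
  ultimately show ?thesis
    by (simp add: lam_def left_diff_distrib)
qed

text \<open>
  Two kernel vectors with a common support are proportional: the combination that cancels one
  coordinate of the support has smaller support, hence vanishes.
\<close>

lemma kernel_line_if_suppker_singleton:
  fixes L :: "'a::field ^ 'n \<Rightarrow> 'a ^ 'm"
  assumes lin: "Vector_Spaces.linear (*s) (*s) L"
    and S: "suppker L = {S}"
  obtains v where "vsupp v = S" "v \<noteq> 0" "\<And>w. L w = 0 \<longleftrightarrow> (\<exists>t. w = t *s v)"
proof -
  interpret L: Vector_Spaces.linear "(*s)" "(*s)" L by (fact lin)
  from S have "S \<in> suppker L" by simp
  then obtain v where v: "L v = 0" "v \<noteq> 0" "vsupp v = S"
    by (auto simp: suppker_def)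
  have supp: "vsupp w = S" if "L w = 0" "w \<noteq> 0" for w
    using S that by (auto simp: suppker_def)
  obtain i where i: "v $ i \<noteq> 0"
    using v(2) by (auto simp: vec_eq_iff)
  have "w = (w $ i / v $ i) *s v" if "L w = 0" for w
  proof (rule ccontr)
    let ?u = "w - (w $ i / v $ i) *s v"
    assume "w \<noteq> (w $ i / v $ i) *s v"
    moreover have "L ?u = 0"
      using that v(1) by (simp add: L.diff L.scale)
    ultimately have "vsupp ?u = S" by (intro supp) auto
    moreover have "i \<in> S" using i v(3) by (auto simp: vsupp_def)
    ultimately have "?u $ i \<noteq> 0" unfolding vsupp_def by blast
    with i show False by simp
  qed
  then have "L w = 0 \<longleftrightarrow> (\<exists>t. w = t *s v)" for w
    using v(1) by (auto simp: L.scale)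
  then show thesis using that v by blast
qed

definition grid_point :: "'p::prime_card mod_ring ^ 'n \<Rightarrow> ('n \<Rightarrow> nat) \<Rightarrow> 'p mod_ring ^ 'n" where
  "grid_point v x = (\<chi> i. (if v $ i = 0 then 1 else v $ i) * of_nat (x i))"

definition grid_set :: "'p::prime_card mod_ring ^ 'n \<Rightarrow> nat \<Rightarrow> 'n \<Rightarrow> 'p mod_ring set" where
  "grid_set v k i = (\<lambda>a. (if v $ i = 0 then 1 else v $ i) * of_nat a) ` {..<k}"

lemma card_grid_set:
  fixes v :: "'p::prime_card mod_ring ^ 'n"
  assumes "k \<le> CARD('p)"
  shows "card (grid_set v k i) = k"
proof -
  have "inj_on (\<lambda>a. (if v $ i = 0 then 1 else v $ i) * (of_nat a :: 'p mod_ring)) {..<k}"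
    using assms by (intro inj_onI) (auto simp: of_nat_mod_ring_eq_iff split: if_splits)
  then show ?thesis by (simp add: grid_set_def card_image)
qed

lemma box_image_grid_set:
  "box_image L (grid_set v k) = (\<lambda>x. L (grid_point v x)) ` {x. \<forall>i. x i < k}"
proof (intro subset_antisym subsetI)
  fix z assume "z \<in> box_image L (grid_set v k)"
  then obtain a where a: "z = L (\<chi> i. a i)" "\<And>i. a i \<in> grid_set v k i"
    by (auto simp: box_image_def)
  have "\<forall>i. \<exists>b<k. a i = (if v $ i = 0 then 1 else v $ i) * of_nat b"
    using a(2) unfolding grid_set_def by blast
  then obtain x where "\<And>i. x i < k" "\<And>i. a i = (if v $ i = 0 then 1 else v $ i) * of_nat (x i)"
    by metis
  then show "z \<in> (\<lambda>x. L (grid_point v x)) ` {x. \<forall>i. x i < k}"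
    using a(1) by (auto simp: grid_point_def)
next
  fix z assume "z \<in> (\<lambda>x. L (grid_point v x)) ` {x. \<forall>i. x i < k}"
  then show "z \<in> box_image L (grid_set v k)"
    unfolding box_image_def grid_point_def grid_set_def by blast
qed

text \<open>
  Dividing by the coordinates of \<open>v\<close> turns translation along the kernel into a simultaneous
  shift of the coordinates in the support, which makes fibres of \<open>L\<close> on the grid explicit.
\<close>

lemma grid_point_image_eq_iff:
  fixes L :: "'p::prime_card mod_ring ^ 'n \<Rightarrow> 'p mod_ring ^ 'm"
  assumes lin: "Vector_Spaces.linear (*s) (*s) L"
    and ker: "\<And>w. L w = 0 \<longleftrightarrow> (\<exists>t. w = t *s v)"
    and k: "k \<le> CARD('p)" and x: "\<And>i. x i < k" and y: "\<And>i. y i < k"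
  shows "L (grid_point v x) = L (grid_point v y) \<longleftrightarrow>
    (\<exists>t. \<forall>i\<in>vsupp v. of_nat (x i) = t + (of_nat (y i) :: 'p mod_ring)) \<and>
    (\<forall>i. i \<notin> vsupp v \<longrightarrow> x i = y i)"
proof -
  interpret L: Vector_Spaces.linear "(*s)" "(*s)" L by (fact lin)
  have inj: "(of_nat (x i) :: 'p mod_ring) = of_nat (y i) \<longleftrightarrow> x i = y i" for i
    using k x y by (intro of_nat_mod_ring_eq_iff) (auto intro: less_le_trans)
  have coord: "grid_point v x $ i - grid_point v y $ i = t * v $ i \<longleftrightarrow>
      (if i \<in> vsupp v then of_nat (x i) = t + (of_nat (y i) :: 'p mod_ring) else x i = y i)" for t i
  proof (cases "v $ i = 0")
    case False
    have "grid_point v x $ i - grid_point v y $ i = v $ i * (of_nat (x i) - of_nat (y i))"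
      using False by (simp add: grid_point_def right_diff_distrib)
    then show ?thesis
      using False by (simp add: vsupp_def mult.commute[of t] diff_eq_eq)
  qed (simp add: grid_point_def vsupp_def inj)
  have "L (grid_point v x) = L (grid_point v y) \<longleftrightarrow>
      (\<exists>t. grid_point v x - grid_point v y = t *s v)"
    using ker[of "grid_point v x - grid_point v y"] by (simp add: L.diff)
  also have "\<dots> \<longleftrightarrow> (\<exists>t. \<forall>i. grid_point v x $ i - grid_point v y $ i = t * v $ i)"
    by (simp add: vec_eq_iff)
  also have "\<dots> \<longleftrightarrow> (\<exists>t. \<forall>i\<in>vsupp v. of_nat (x i) = t + (of_nat (y i) :: 'p mod_ring)) \<and>
    (\<forall>i. i \<notin> vsupp v \<longrightarrow> x i = y i)"
    unfolding coord by auto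
  finally show ?thesis .
qed

lemma box_image_eq_vanishing_image:
  fixes L :: "'p::prime_card mod_ring ^ 'n \<Rightarrow> 'p mod_ring ^ 'm"
  assumes lin: "Vector_Spaces.linear (*s) (*s) L"
    and ker: "\<And>w. L w = 0 \<longleftrightarrow> (\<exists>t. w = t *s v)"
    and v: "v \<noteq> 0" and k: "k \<le> CARD('p)"
  shows "box_image L (grid_set v k) =
    (\<lambda>x. L (grid_point v x)) ` {x. (\<forall>i. x i < k) \<and> (\<exists>i\<in>vsupp v. x i = 0)}"
proof -
  have "L (grid_point v x) \<in>
      (\<lambda>x. L (grid_point v x)) ` {x. (\<forall>i. x i < k) \<and> (\<exists>i\<in>vsupp v. x i = 0)}"
    if x: "\<And>i. x i < k" for x
  proof -
    define c where "c = Min (x ` vsupp v)"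
    define y where "y = (\<lambda>i. if i \<in> vsupp v then x i - c else x i)"
    have ne: "vsupp v \<noteq> {}" using v by (auto simp: vsupp_def vec_eq_iff)
    then have "c \<in> x ` vsupp v"
      unfolding c_def by (intro Min_in) auto
    then obtain i where i: "i \<in> vsupp v" "x i = c" by auto
    have c: "c \<le> x j" if "j \<in> vsupp v" for j
      unfolding c_def using that by (intro Min_le) auto
    have y: "y j < k" for j
      using x[of j] by (simp add: y_def less_imp_diff_less)
    have "L (grid_point v x) = L (grid_point v y)"
      unfolding grid_point_image_eq_iff[OF lin ker k x y]
      using c by (auto simp: y_def of_nat_diff intro!: exI[of _ "of_nat c"])
    moreover have "y i = 0" using i by (simp add: y_def)
    ultimately show ?thesis using i(1) y by blast
  qed
  then show ?thesis unfolding box_image_grid_set by blast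
qed

text \<open>
  A zero of \<open>x\<close> and a zero of \<open>y\<close> turn a shift relating \<open>x\<close> and \<open>y\<close> into the congruence
  \<open>x j + y i \<equiv> 0\<close>.  The bound \<open>2 * k - 1 \<le> p\<close> says precisely that such a sum stays below \<open>p\<close>, so
  the shift is zero.
\<close>

lemma grid_point_image_inj_on:
  fixes L :: "'p::prime_card mod_ring ^ 'n \<Rightarrow> 'p mod_ring ^ 'm"
  assumes lin: "Vector_Spaces.linear (*s) (*s) L"
    and ker: "\<And>w. L w = 0 \<longleftrightarrow> (\<exists>t. w = t *s v)"
    and k: "1 \<le> k" "2 * k - 1 \<le> CARD('p)"
  shows "inj_on (\<lambda>x. L (grid_point v x)) {x. (\<forall>i. x i < k) \<and> (\<exists>i\<in>vsupp v. x i = 0)}"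
proof (rule inj_onI, clarify)
  fix x y i j
  assume x: "\<forall>i. x i < k" and y: "\<forall>i. y i < k"
    and i: "i \<in> vsupp v" "x i = 0" and j: "j \<in> vsupp v" "y j = 0"
    and eq: "L (grid_point v x) = L (grid_point v y)"
  have kp: "k \<le> CARD('p)" using k by linarith
  from eq obtain t :: "'p mod_ring"
    where t: "\<And>l. l \<in> vsupp v \<Longrightarrow> of_nat (x l) = t + of_nat (y l)"
      and off: "\<And>l. l \<notin> vsupp v \<Longrightarrow> x l = y l"
    using grid_point_image_eq_iff[OF lin ker kp] x y by blast
  have "x j + y i < CARD('p)"
    using x[rule_format, of j] y[rule_format, of i] k by linarith
  moreover have "(of_nat (x j + y i) :: 'p mod_ring) = of_nat 0"
    using t[OF i(1)] t[OF j(1)] i j by simp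
  ultimately have "x j + y i = 0"
    by (subst (asm) of_nat_mod_ring_eq_iff) auto
  then have "t = 0" using t[OF j(1)] j by simp
  then have "(of_nat (x l) :: 'p mod_ring) = of_nat (y l)" if "l \<in> vsupp v" for l
    using t[OF that] by simp
  then have "x l = y l" for l
    using off kp x y by (metis of_nat_mod_ring_eq_iff less_le_trans)
  then show "x = y" by blast
qed

text \<open>
  With two support coordinates available, the profiles \<open>(0, k - 1, k - 1, \<dots>)\<close> and
  \<open>(p - (k - 1), 0, 0, \<dots>)\<close> differ by the constant \<open>k - 1\<close> modulo \<open>p\<close>, and both fit into the grid
  once \<open>p \<le> 2 * (k - 1)\<close>.
\<close>

lemma grid_point_image_collision:
  fixes L :: "'p::prime_card mod_ring ^ 'n \<Rightarrow> 'p mod_ring ^ 'm"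
  assumes lin: "Vector_Spaces.linear (*s) (*s) L"
    and ker: "\<And>w. L w = 0 \<longleftrightarrow> (\<exists>t. w = t *s v)"
    and k: "k \<le> CARD('p)" "CARD('p) < 2 * k - 1" and S: "2 \<le> card (vsupp v)"
  shows "\<not> inj_on (\<lambda>x. L (grid_point v x)) {x. (\<forall>i. x i < k) \<and> (\<exists>i\<in>vsupp v. x i = 0)}"
proof -
  from S obtain i j where ij: "i \<in> vsupp v" "j \<in> vsupp v" "i \<noteq> j"
    by (metis card_2_iff' obtain_subset_with_card_n subsetD)
  define x where "x = (\<lambda>l. if l \<in> vsupp v \<and> l \<noteq> i then k - 1 else 0)"
  define y where "y = (\<lambda>l. if l = i then CARD('p) - (k - 1) else 0)"
  have x: "x l < k" and y: "y l < k" for l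
    using k by (auto simp: x_def y_def)
  have "(of_nat (k - 1) + of_nat (CARD('p) - (k - 1)) :: 'p mod_ring) = of_nat (CARD('p))"
    using k by (simp flip: of_nat_add)
  also have "\<dots> = 0"
    using of_nat_CHAR[where 'a = "'p mod_ring"] by simp
  finally have "L (grid_point v x) = L (grid_point v y)"
    unfolding grid_point_image_eq_iff[OF lin ker k(1) x y]
    using ij by (auto simp: x_def y_def intro!: exI[of _ "of_nat (k - 1)"])
  moreover have "x i = 0" "y j = 0" "y i \<noteq> 0"
    using ij k by (auto simp: x_def y_def)
  moreover from this have "x \<noteq> y" by metis
  ultimately show ?thesis
    unfolding inj_on_def using ij x y by blast
qed

theorem lemma2p3:
  fixes p n m k :: nat
    and L :: "('p::prime_card) mod_ring ^ 'n \<Rightarrow> 'p mod_ring ^ 'm"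
    and S :: "'n set"
    and ks :: "'n \<Rightarrow> nat"
  assumes "prime p" and "CARD('p) = p"
    and "n \<ge> 2" and "CARD('n) = n"
    and "m = n - 1" and "CARD('m) = m"
    and "Vector_Spaces.linear (*s) (*s) L"
    and "vec.dim (range L) = m"
    and "suppker L = {S}"
    and "1 \<le> k" and "k \<le> p"
    and "\<forall>i. ks i = k"
  shows "(int p \<ge> 2 * int k - 1 \<longrightarrow>
            (\<exists>A :: 'n \<Rightarrow> 'p mod_ring set.
               (\<forall>i. card (A i) = ks i) \<and> int (card (box_image L A)) = lam S ks)) \<and>
         (int p < 2 * int k - 1 \<and> card S \<ge> 2 \<longrightarrow>
            (\<exists>A :: 'n \<Rightarrow> 'p mod_ring set.
               (\<forall>i. card (A i) = ks i) \<and> int (card (box_image L A)) < lam S ks))"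
proof -
  obtain v where v: "vsupp v = S" "v \<noteq> 0" and ker: "\<And>w. L w = 0 \<longleftrightarrow> (\<exists>t. w = t *s v)"
    using kernel_line_if_suppker_singleton[OF assms(7,9)] by blast
  define N where "N = {x :: 'n \<Rightarrow> nat. (\<forall>i. x i < k) \<and> (\<exists>i\<in>vsupp v. x i = 0)}"
  have lam: "int (card N) = lam S ks"
    using card_grid_vanishing[of ks S] assms(10,12) v(1) by (simp add: N_def)
  have kp: "k \<le> CARD('p)" using assms by simp
  have img: "box_image L (grid_set v k) = (\<lambda>x. L (grid_point v x)) ` N"
    unfolding N_def by (rule box_image_eq_vanishing_image[OF assms(7) ker v(2) kp])
  have fin: "finite N"
  proof (rule finite_subset)
    show "N \<subseteq> PiE UNIV (\<lambda>_. {..<k})" by (auto simp: N_def PiE_UNIV_domain)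
  qed (auto intro!: finite_PiE)
  have cards: "\<forall>i. card (grid_set v k i) = ks i"
    using assms(12) by (simp add: card_grid_set[OF kp])
  have "int (card (box_image L (grid_set v k))) = lam S ks" if "int p \<ge> 2 * int k - 1"
  proof -
    have "2 * k - 1 \<le> CARD('p)" using that assms(2) by linarith
    then have "inj_on (\<lambda>x. L (grid_point v x)) N"
      unfolding N_def by (rule grid_point_image_inj_on[OF assms(7) ker assms(10)])
    then show ?thesis unfolding img by (simp add: card_image lam)
  qed
  moreover have "int (card (box_image L (grid_set v k))) < lam S ks"
    if "int p < 2 * int k - 1" "card S \<ge> 2"
  proof -
    have "CARD('p) < 2 * k - 1" using that assms(2) by linarith
    then have "\<not> inj_on (\<lambda>x. L (grid_point v x)) N"
      unfolding N_def using that(2) v(1)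
      by (intro grid_point_image_collision[OF assms(7) ker kp]) auto
    then have "card ((\<lambda>x. L (grid_point v x)) ` N) < card N"
      using fin by (metis card_image_le eq_card_imp_inj_on le_neq_implies_less)
    then show ?thesis unfolding img lam[symmetric] by simp
  qed
  ultimately show ?thesis using cards by blast
qed

end
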